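(* Let $Q$ be a geometric distribution on $\mathbb{N}=\{1,2,\ldots\}$, i.e. $Q(x)=\alpha(1-\alpha)^{x-1}$ for all $x\ge 1$, for some $\alpha\in(0,1)$. Let $P$ be a log-concave distribution on $\mathbb{Z}_+$ with $P(0)P(1)>0$ that satisfies $$\frac{P(1)^2-P(0)P(2)}{P(0)P(1)}\ge\frac{Q(2)}{Q(1)^2}.$$ Then $C_QP$ is log-concave.
   Context: All distributions are probability mass functions on $\mathbb{Z}_+=\{0,1,2,\ldots\}$. A distribution $P$ on $\mathbb{Z}_+$ is log-concave if its support is a (possibly infinite) interval of successive integers and $P(x)^2\ge P(x+1)P(x-1)$ for all $x\ge 1$. For a distribution $P$ on $\mathbb{Z}_+$ and a distribution $Q$ on $\mathbb{N}$, $C_QP(x)=\sum_{y=0}^\infty P(y)Q^{*y}(x)$, $x\ge 0$, where $Q^{*y}$ is the $y$-th convolution power of $Q$ and $Q^{*0}$ is the point mass at $0$. *)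

theory Defs
  imports "HOL-Probability.Probability"
begin

definition log_concave_pmf :: "nat pmf \<Rightarrow> bool" where
  "log_concave_pmf P \<longleftrightarrow>
     (\<forall>i j k. i \<in> set_pmf P \<longrightarrow> k \<in> set_pmf P \<longrightarrow> i \<le> j \<longrightarrow> j \<le> k \<longrightarrow> j \<in> set_pmf P) \<and>
     (\<forall>x\<ge>1. (pmf P x)\<^sup>2 \<ge> pmf P (x + 1) * pmf P (x - 1))"

definition conv_pmf :: "nat pmf \<Rightarrow> nat pmf \<Rightarrow> nat pmf" where
  "conv_pmf P Q = map_pmf (\<lambda>(i, j). i + j) (pair_pmf P Q)"

primrec conv_power_pmf :: "nat pmf \<Rightarrow> nat \<Rightarrow> nat pmf" where
  "conv_power_pmf Q 0 = return_pmf 0"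
| "conv_power_pmf Q (Suc y) = conv_pmf Q (conv_power_pmf Q y)"

text \<open>
  The compound distribution C_Q P is the law of a sum of N independent variables of law Q,
  with N of law P. Its mass function is the series P(0) Q^{*0}(x) + P(1) Q^{*1}(x) + ...,
  see \<open>sums_pmf_compound\<close> and \<open>pmf_compound\<close>.
\<close>

definition compound_pmf :: "nat pmf \<Rightarrow> nat pmf \<Rightarrow> nat pmf" where
  "compound_pmf Q P = bind_pmf P (conv_power_pmf Q)"

lemma pmf_conv: "pmf (conv_pmf P Q) x = (\<Sum>i\<le>x. pmf P i * pmf Q (x - i))"
proof -
  have "(\<lambda>(i, j). i + j) -` {x} = (\<lambda>i. (i, x - i)) ` {..x}"
    by (auto simp: image_iff)
  then have "pmf (conv_pmf P Q) x
      = measure (measure_pmf (pair_pmf P Q)) ((\<lambda>i. (i, x - i)) ` {..x})"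
    by (simp add: conv_pmf_def pmf_map)
  also have "\<dots> = (\<Sum>p\<in>(\<lambda>i. (i, x - i)) ` {..x}. pmf (pair_pmf P Q) p)"
    by (simp add: measure_measure_pmf_finite)
  also have "\<dots> = (\<Sum>i\<le>x. pmf P i * pmf Q (x - i))"
    by (subst sum.reindex) (auto simp: inj_on_def pmf_pair)
  finally show ?thesis .
qed

lemma sums_pmf_compound:
  "(\<lambda>y. pmf P y * pmf (conv_power_pmf Q y) x) sums pmf (compound_pmf Q P) x"
proof -
  let ?f = "\<lambda>y. pmf P y * pmf (conv_power_pmf Q y) x"
  have int: "integrable (count_space UNIV) ?f"
    by (rule Bochner_Integration.integrable_bound[OF integrable_pmf[of UNIV P]])
       (auto intro!: mult_right_le_one_le simp: pmf_le_1)
  have "pmf (compound_pmf Q P) x = (\<integral>y. ?f y \<partial>count_space UNIV)"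
    by (simp add: compound_pmf_def pmf_bind measure_pmf_eq_density integral_density)
  then show ?thesis
    using sums_integral_count_space_nat[OF int] by simp
qed

lemma pmf_compound:
  "pmf (compound_pmf Q P) x = (\<Sum>y. pmf P y * pmf (conv_power_pmf Q y) x)"
  using sums_pmf_compound by (simp add: sums_iff)

end

theory Submission
  imports Defs
begin

text \<open>
  For geometric \<open>Q\<close>, the convolution powers satisfy
  \<open>Q^{*(y+1)}(x+1) = (1 - \<alpha>) Q^{*(y+1)}(x) + \<alpha> Q^{*y}(x)\<close>. Summing against \<open>P\<close> moves this
  recursion onto \<open>P\<close>: with the averaging operator \<open>(T a)(k) = (1 - \<alpha>) a(k) + \<alpha> a(k+1)\<close>,
  the compound mass at \<open>n + 1\<close> is \<open>\<alpha> (T\<^sup>n P)(1)\<close>. The operator \<open>T\<close> preserves log-concavity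
  without internal zeros, and for log-concave \<open>a\<close> one has \<open>(T a)(1)\<^sup>2 \<ge> a(1) (T\<^sup>2 a)(1)\<close>,
  which gives the inequality at every \<open>x \<ge> 2\<close>. At \<open>x = 1\<close> it is exactly the hypothesis
  relating \<open>P\<close> and \<open>Q\<close>.
\<close>

text \<open>For non-negative sequences this says log-concave without internal zeros.\<close>

definition strongly_log_concave :: "(nat \<Rightarrow> real) \<Rightarrow> bool" where
  "strongly_log_concave a \<longleftrightarrow> (\<forall>i j. i \<le> j \<longrightarrow> a i * a (j + 2) \<le> a (i + 1) * a (j + 1))"

lemma strongly_log_concaveD:
  "strongly_log_concave a \<Longrightarrow> i \<le> j \<Longrightarrow> a i * a (j + 2) \<le> a (i + 1) * a (j + 1)"
  by (simp add: strongly_log_concave_def)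

text \<open>Induction on \<open>j\<close>: multiply the inequality for \<open>j\<close> by
  log-concavity at \<open>j + 2\<close> and cancel \<open>P(j+1) P(j+2)\<close>. This factor is
  positive because the support is an interval, unless \<open>P(i)\<close> or \<open>P(j+3)\<close>
  vanishes, and then the claim is trivial.\<close>

lemma log_concave_pmf_imp_strongly_log_concave:
  assumes "log_concave_pmf P"
  shows "strongly_log_concave (pmf P)"
  unfolding strongly_log_concave_def
proof (intro allI impI)
  fix i j :: nat assume "i \<le> j"
  then show "pmf P i * pmf P (j + 2) \<le> pmf P (i + 1) * pmf P (j + 1)"
  proof (induction j rule: dec_induct)
    case base
    have "pmf P (i + 1 + 1) * pmf P (i + 1 - 1) \<le> (pmf P (i + 1))\<^sup>2"
      using assms by (auto simp: log_concave_pmf_def)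
    then show ?case by (simp add: power2_eq_square mult.commute)
  next
    case (step j)
    show ?case
    proof (cases "pmf P i = 0 \<or> pmf P (j + 3) = 0")
      case True
      then show ?thesis by (auto simp: eval_nat_numeral)
    next
      case False
      then have mem: "i \<in> set_pmf P" "j + 3 \<in> set_pmf P" by (auto simp: set_pmf_iff)
      have between: "k \<in> set_pmf P" if "i \<le> k" "k \<le> j + 3" for k
        using assms mem that unfolding log_concave_pmf_def by blast
      have "j + 1 \<in> set_pmf P" "j + 2 \<in> set_pmf P"
        using step.hyps by (auto intro!: between)
      then have pos: "pmf P (j + 1) * pmf P (j + 2) > 0"
        by (simp add: pmf_positive)
      have "pmf P (j + 2 + 1) * pmf P (j + 2 - 1) \<le> (pmf P (j + 2))\<^sup>2"
        using assms by (auto simp: log_concave_pmf_def)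
      then have lc: "pmf P (j + 3) * pmf P (j + 1) \<le> (pmf P (j + 2))\<^sup>2"
        by (simp add: numeral_3_eq_3 numeral_2_eq_2)
      have "(pmf P i * pmf P (j + 2)) * (pmf P (j + 3) * pmf P (j + 1))
          \<le> (pmf P (i + 1) * pmf P (j + 1)) * (pmf P (j + 2))\<^sup>2"
        by (intro mult_mono step.IH lc) auto
      then have "(pmf P i * pmf P (j + 3)) * (pmf P (j + 1) * pmf P (j + 2))
          \<le> (pmf P (i + 1) * pmf P (j + 2)) * (pmf P (j + 1) * pmf P (j + 2))"
        by (simp add: power2_eq_square mult_ac)
      then have "pmf P i * pmf P (j + 3) \<le> pmf P (i + 1) * pmf P (j + 2)"
        using pos by (rule mult_right_le_imp_le)
      then show ?thesis by (simp add: numeral_3_eq_3 numeral_2_eq_2)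
    qed
  qed
qed

definition shift_average :: "real \<Rightarrow> (nat \<Rightarrow> real) \<Rightarrow> nat \<Rightarrow> real" where
  "shift_average \<alpha> a k = (1 - \<alpha>) * a k + \<alpha> * a (Suc k)"

text \<open>Both products expand into four terms with the same nonnegative weights, compared one by
  one. Even for \<open>i = j\<close> the term \<open>a i * a (j + 3)\<close> involves non-adjacent
  inner indices, so the inequality is needed for all \<open>i \<le> j\<close>.\<close>

lemma strongly_log_concave_shift_average:
  assumes "0 \<le> \<alpha>" "\<alpha> \<le> 1" "strongly_log_concave a"
  shows "strongly_log_concave (shift_average \<alpha> a)"
  unfolding strongly_log_concave_def
proof (intro allI impI)
  fix i j :: nat assume ij: "i \<le> j"
  define q where "q = 1 - \<alpha>"
  have q: "q \<ge> 0" using assms by (simp add: q_def)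
  have 1: "a i * a (j + 2) \<le> a (i + 1) * a (j + 1)"
    by (rule strongly_log_concaveD[OF assms(3) ij])
  have 2: "a i * a (j + 3) \<le> a (i + 1) * a (j + 2)"
    using strongly_log_concaveD[OF assms(3), of i "j + 1"] ij
    by (simp add: numeral_3_eq_3 numeral_2_eq_2)
  have 3: "a (i + 1) * a (j + 3) \<le> a (i + 2) * a (j + 2)"
    using strongly_log_concaveD[OF assms(3), of "i + 1" "j + 1"] ij
    by (simp add: numeral_3_eq_3 numeral_2_eq_2)
  \<comment> \<open>For \<open>i = j\<close> the shifted instance would need
    \<open>i + 1 \<le> j\<close>, but both sides then agree by commutativity.\<close>
  have 4: "a (i + 1) * a (j + 2) \<le> a (i + 2) * a (j + 1)"
  proof (cases "i = j")
    case False
    then show ?thesis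
      using strongly_log_concaveD[OF assms(3), of "i + 1" j] ij
      by (simp add: numeral_2_eq_2)
  qed (simp add: mult.commute)
  have "(q * a i + \<alpha> * a (i + 1)) * (q * a (j + 2) + \<alpha> * a (j + 3))
      = (q * q) * (a i * a (j + 2)) + (q * \<alpha>) * (a i * a (j + 3))
        + (q * \<alpha>) * (a (i + 1) * a (j + 2)) + (\<alpha> * \<alpha>) * (a (i + 1) * a (j + 3))"
    by (simp add: algebra_simps)
  also have "\<dots> \<le> (q * q) * (a (i + 1) * a (j + 1)) + (q * \<alpha>) * (a (i + 1) * a (j + 2))
        + (q * \<alpha>) * (a (i + 2) * a (j + 1)) + (\<alpha> * \<alpha>) * (a (i + 2) * a (j + 2))"
    using 1 2 3 4 q assms(1) by (intro add_mono mult_left_mono) auto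
  also have "\<dots> = (q * a (i + 1) + \<alpha> * a (i + 2)) * (q * a (j + 1) + \<alpha> * a (j + 2))"
    by (simp add: algebra_simps)
  finally show "shift_average \<alpha> a i * shift_average \<alpha> a (j + 2)
      \<le> shift_average \<alpha> a (i + 1) * shift_average \<alpha> a (j + 1)"
    by (simp add: shift_average_def q_def numeral_3_eq_3 numeral_2_eq_2)
qed

text \<open>Every term with a factor \<open>1 - \<alpha>\<close> cancels in the difference of the
  two sides, leaving \<open>\<alpha>\<^sup>2\<close> times the log-concavity defect of
  \<open>a\<close> at \<open>k + 1\<close>.\<close>

lemma shift_average_iterates_log_concave:
  assumes "strongly_log_concave a"
  shows "a k * shift_average \<alpha> (shift_average \<alpha> a) k \<le> (shift_average \<alpha> a k)\<^sup>2"
proof -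
  have "(shift_average \<alpha> a k)\<^sup>2 - a k * shift_average \<alpha> (shift_average \<alpha> a) k
      = \<alpha>\<^sup>2 * (a (k + 1) * a (k + 1) - a k * a (k + 2))"
    by (simp add: shift_average_def power2_eq_square algebra_simps)
  also have "\<dots> \<ge> 0"
    using strongly_log_concaveD[OF assms order_refl, of k]
    by (intro mult_nonneg_nonneg) auto
  finally show ?thesis by simp
qed

locale geometric_pmf_pos =
  fixes Q :: "nat pmf" and \<alpha> :: real
  assumes alpha: "0 < \<alpha>" "\<alpha> < 1"
    and support: "set_pmf Q \<subseteq> {1..}"
    and pmf_Q: "\<And>x. x \<ge> 1 \<Longrightarrow> pmf Q x = \<alpha> * (1 - \<alpha>) ^ (x - 1)"
begin

lemma pmf_Q_0: "pmf Q 0 = 0"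
  using support by (auto simp: pmf_eq_0_set_pmf)

lemma pmf_Q_Suc: "pmf Q (Suc x) = \<alpha> * (1 - \<alpha>) ^ x"
  using pmf_Q[of "Suc x"] by simp

lemma conv_power_Suc_0: "pmf (conv_power_pmf Q (Suc y)) 0 = 0"
  by (simp add: pmf_conv pmf_Q_0)

text \<open>Memorylessness: in the convolution with \<open>Q\<close>, the summand where the
  geometric variable equals 1 gives the last term, and lowering that variable by 1 in the others
  extracts the factor \<open>1 - \<alpha>\<close>.\<close>

lemma conv_power_Suc_Suc:
  "pmf (conv_power_pmf Q (Suc y)) (Suc x)
    = (1 - \<alpha>) * pmf (conv_power_pmf Q (Suc y)) x + \<alpha> * pmf (conv_power_pmf Q y) x"
proof -
  let ?u = "pmf (conv_power_pmf Q y)"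
  have conv: "pmf (conv_power_pmf Q (Suc y)) (Suc z)
      = (\<Sum>i\<le>z. \<alpha> * (1 - \<alpha>) ^ i * ?u (z - i))" for z
    by (simp add: pmf_conv sum.atMost_Suc_shift pmf_Q_0 pmf_Q_Suc del: sum.atMost_Suc)
  show ?thesis
  proof (cases x)
    case 0
    then show ?thesis by (simp add: conv conv_power_Suc_0 del: conv_power_pmf.simps)
  next
    case (Suc z)
    show ?thesis
      unfolding Suc conv
      by (simp add: sum.atMost_Suc_shift sum_distrib_left mult_ac del: sum.atMost_Suc)
  qed
qed

lemma conv_power_eq_0: "x < y \<Longrightarrow> pmf (conv_power_pmf Q y) x = 0"
proof (induction x arbitrary: y)
  case 0
  then show ?case by (cases y) (simp_all add: conv_power_Suc_0 del: conv_power_pmf.simps(2))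
next
  case (Suc x)
  then show ?case
    by (cases y) (simp_all add: conv_power_Suc_Suc del: conv_power_pmf.simps(2))
qed

text \<open>Weights are arbitrary real sequences because \<open>shift_average\<close> need not
  return a probability mass function. Stopping the sum at \<open>x\<close> loses nothing by
  \<open>conv_power_eq_0\<close>.\<close>

definition mixture :: "(nat \<Rightarrow> real) \<Rightarrow> nat \<Rightarrow> real" where
  "mixture a x = (\<Sum>y\<le>x. a y * pmf (conv_power_pmf Q y) x)"

lemma pmf_compound_eq_mixture: "pmf (compound_pmf Q P) x = mixture (pmf P) x"
  unfolding mixture_def pmf_compound
  by (rule suminf_finite) (auto simp: conv_power_eq_0)

lemma mixture_Suc_Suc: "mixture a (Suc (Suc n)) = mixture (shift_average \<alpha> a) (Suc n)"
proof -
  let ?u = "\<lambda>y. pmf (conv_power_pmf Q y)"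
  let ?m = "Suc n"
  have u0: "?u 0 (Suc k) = 0" for k by simp
  have "mixture a (Suc ?m) = (\<Sum>y\<le>?m. a (Suc y) * ?u (Suc y) (Suc ?m))"
    unfolding mixture_def by (subst sum.atMost_Suc_shift) (simp only: u0)
  also have "\<dots> = (1 - \<alpha>) * (\<Sum>y\<le>?m. a (Suc y) * ?u (Suc y) ?m)
      + \<alpha> * (\<Sum>y\<le>?m. a (Suc y) * ?u y ?m)"
    unfolding conv_power_Suc_Suc[of _ ?m] sum_distrib_left sum.distrib[symmetric]
    by (rule sum.cong) (simp_all add: algebra_simps del: conv_power_pmf.simps)
  \<comment> \<open>The missing index \<open>y = 0\<close> may be added because the point mass at 0
    vanishes at \<open>?m > 0\<close>. This is why the recursion starts at \<open>Suc n\<close>: at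
    0 the extra term would be \<open>a 0\<close>.\<close>
  also have "(\<Sum>y\<le>?m. a (Suc y) * ?u (Suc y) ?m) = (\<Sum>y\<le>Suc ?m. a y * ?u y ?m)"
    by (subst (2) sum.atMost_Suc_shift) (simp only: u0)
  also have "\<dots> = (\<Sum>y\<le>?m. a y * ?u y ?m)"
    by (simp add: conv_power_eq_0 del: conv_power_pmf.simps)
  finally show ?thesis
    unfolding mixture_def shift_average_def sum_distrib_left sum.distrib[symmetric]
    by (simp add: algebra_simps del: conv_power_pmf.simps sum.atMost_Suc)
qed

lemma mixture_Suc: "mixture a (Suc n) = \<alpha> * (shift_average \<alpha> ^^ n) a 1"
proof (induction n arbitrary: a)
  case 0
  show ?case
    by (simp add: mixture_def conv_power_Suc_Suc conv_power_Suc_0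
        del: conv_power_pmf.simps(2))
next
  case (Suc n)
  then show ?case by (simp add: mixture_Suc_Suc funpow_swap1)
qed

lemma shift_average_funpow_nonneg:
  assumes "\<And>k. a k \<ge> 0"
  shows "(shift_average \<alpha> ^^ n) a k \<ge> 0"
  using alpha assms by (induction n arbitrary: k) (simp_all add: shift_average_def)

text \<open>Since \<open>\<alpha> < 1\<close>, each averaging keeps a positive share of the value at
  \<open>k\<close> itself. At \<open>k = 1\<close> this gives the compound distribution full
  support.\<close>

lemma shift_average_funpow_pos:
  assumes "\<And>k. a k \<ge> 0" "a k > 0"
  shows "(shift_average \<alpha> ^^ n) a k > 0"
proof (induction n)
  case (Suc n)
  have "0 < (1 - \<alpha>) * (shift_average \<alpha> ^^ n) a k + \<alpha> * (shift_average \<alpha> ^^ n) a (Suc k)"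
    using alpha Suc.IH
    by (intro add_pos_nonneg mult_pos_pos mult_nonneg_nonneg shift_average_funpow_nonneg assms(1))
       auto
  then show ?case
    by (simp only: funpow.simps comp_apply shift_average_def[of _ "(shift_average \<alpha> ^^ n) a"])
qed (simp add: assms)

lemma strongly_log_concave_shift_average_funpow:
  "strongly_log_concave a \<Longrightarrow> strongly_log_concave ((shift_average \<alpha> ^^ n) a)"
  using alpha by (induction n) (simp_all add: strongly_log_concave_shift_average)

text \<open>By \<open>mixture_Suc\<close>, the three masses are \<open>\<alpha>\<close> times the
  values at 1 of \<open>b\<close>, \<open>T b\<close> and \<open>T (T b)\<close>, where
  \<open>T\<close> is \<open>shift_average \<alpha>\<close> and \<open>b\<close> its
  \<open>n\<close>-th iterate on \<open>a\<close>.\<close>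

lemma mixture_log_concave:
  assumes "strongly_log_concave a"
  shows "mixture a (Suc n) * mixture a (Suc (Suc (Suc n))) \<le> (mixture a (Suc (Suc n)))\<^sup>2"
proof -
  let ?b = "(shift_average \<alpha> ^^ n) a"
  have "\<alpha>\<^sup>2 * (?b 1 * shift_average \<alpha> (shift_average \<alpha> ?b) 1)
      \<le> \<alpha>\<^sup>2 * (shift_average \<alpha> ?b 1)\<^sup>2"
    by (intro mult_left_mono shift_average_iterates_log_concave
        strongly_log_concave_shift_average_funpow assms) simp
  then show ?thesis
    by (simp add: mixture_Suc power2_eq_square mult_ac)
qed

end

theorem theorem4p4:
  fixes P Q :: "nat pmf" and \<alpha> :: real
  assumes "0 < \<alpha>" and "\<alpha> < 1"
    and "set_pmf Q \<subseteq> {1..}"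
    and "\<And>x. x \<ge> 1 \<Longrightarrow> pmf Q x = \<alpha> * (1 - \<alpha>) ^ (x - 1)"
    and "log_concave_pmf P"
    and "pmf P 0 * pmf P 1 > 0"
    and "((pmf P 1)\<^sup>2 - pmf P 0 * pmf P 2) / (pmf P 0 * pmf P 1) \<ge> pmf Q 2 / (pmf Q 1)\<^sup>2"
  shows "log_concave_pmf (compound_pmf Q P)"
proof -
  interpret geometric_pmf_pos Q \<alpha>
    using assms(1-4) by unfold_locales auto
  have P_pos: "pmf P 0 > 0" "pmf P 1 > 0"
    using assms(6) by (auto simp: zero_less_mult_iff not_less[symmetric])
  have C_0: "pmf (compound_pmf Q P) 0 = pmf P 0"
    by (simp add: pmf_compound_eq_mixture mixture_def)
  have C_pos: "pmf (compound_pmf Q P) x > 0" for x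
  proof (cases x)
    case 0
    then show ?thesis using P_pos C_0 by simp
  next
    case (Suc n)
    then show ?thesis
      using P_pos assms(1) shift_average_funpow_pos[of "pmf P" 1 n]
      by (simp add: pmf_compound_eq_mixture mixture_Suc)
  qed
  have "pmf Q 2 / (pmf Q 1)\<^sup>2 = (1 - \<alpha>) / \<alpha>"
    using assms(1) by (simp add: assms(4) power2_eq_square)
  then have "(1 - \<alpha>) / \<alpha> \<le> ((pmf P 1)\<^sup>2 - pmf P 0 * pmf P 2) / (pmf P 0 * pmf P 1)"
    using assms(7) by simp
  then have "(1 - \<alpha>) * (pmf P 0 * pmf P 1) \<le> \<alpha> * ((pmf P 1)\<^sup>2 - pmf P 0 * pmf P 2)"
    using assms(1,6) by (simp add: divide_simps mult_ac split: if_splits)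
  \<comment> \<open>The additional factor \<open>\<alpha>\<close> makes the difference of the two
    sides equal to \<open>C(1)\<^sup>2 - C(0) C(2)\<close> for the compound masses
    \<open>C\<close>.\<close>
  then have cond: "\<alpha> * ((1 - \<alpha>) * (pmf P 0 * pmf P 1))
      \<le> \<alpha> * (\<alpha> * ((pmf P 1)\<^sup>2 - pmf P 0 * pmf P 2))"
    using assms(1) by (intro mult_left_mono) auto
  have C_1: "mixture (pmf P) 1 = \<alpha> * pmf P 1"
    using mixture_Suc[of "pmf P" 0] by simp
  have C_2: "mixture (pmf P) 2 = \<alpha> * ((1 - \<alpha>) * pmf P 1 + \<alpha> * pmf P 2)"
    using mixture_Suc[of "pmf P" 1] by (simp add: shift_average_def numeral_2_eq_2)
  have "(mixture (pmf P) 1)\<^sup>2 - mixture (pmf P) 2 * pmf P 0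
      = \<alpha> * (\<alpha> * ((pmf P 1)\<^sup>2 - pmf P 0 * pmf P 2)) - \<alpha> * ((1 - \<alpha>) * (pmf P 0 * pmf P 1))"
    unfolding C_1 C_2 by (simp add: power2_eq_square algebra_simps)
  then have lc_1: "mixture (pmf P) 2 * pmf P 0 \<le> (mixture (pmf P) 1)\<^sup>2"
    using cond by linarith
  have lc: "pmf (compound_pmf Q P) (x + 1) * pmf (compound_pmf Q P) (x - 1)
      \<le> (pmf (compound_pmf Q P) x)\<^sup>2" if "x \<ge> 1" for x
  proof (cases "x = 1")
    case True
    then show ?thesis using lc_1 C_0 by (simp add: pmf_compound_eq_mixture numeral_2_eq_2)
  next
    case False
    define n where "n = x - 2"
    have "x = Suc (Suc n)"
      using that False by (simp add: n_def)
    then show ?thesis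
      using mixture_log_concave[OF log_concave_pmf_imp_strongly_log_concave[OF assms(5)], of n]
      by (simp add: pmf_compound_eq_mixture mult.commute)
  qed
  \<comment> \<open>Full support makes the interval condition trivial.\<close>
  have "x \<in> set_pmf (compound_pmf Q P)" for x
    using C_pos[of x] by (simp add: set_pmf_iff)
  then show ?thesis
    using lc by (auto simp: log_concave_pmf_def)
qed

end
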